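(* There is a function $\varepsilon:\mathbb{N}\to\mathbb{R}$ with $\varepsilon(d)\to 0$ as $d\to\infty$ such that for every additive set $A$ (a finite subset of an abelian group $G$) with $d_d(A)\geq 2$, \[ \frac{d_s^-(A)}{d_d(A)}\;\geq\;\frac{1}{\log_4 d_d(A)}\,\big(1+\varepsilon(d_d(A))\big). \] That is, $\frac{d_s^-(A)}{d_d(A)}\geq \frac{1}{\log_4 d_d(A)}(1+o(1))$ as $d_d(A)\to\infty$.
   Context: An additive set is a finite subset $A$ of an abelian group $G$. A set $D$ in an abelian group is dissociated if its subset sums $\sum_{x\in D'}x$ ($D'\subset D$) are pairwise distinct; equivalently the only combination $\sum_{x\in D}\varepsilon_x x$ with $\varepsilon_x\in\{-1,0,1\}$ equal to $0$ is the trivial one. The dissociativity dimension is $d_d(A)=\max\{|D|: D\subset A \text{ dissociated}\}$. For $S\subset G$, the 1-span $\langle S\rangle$ is the set of all sums $\sum_{s\in S}\varepsilon_s s$ with $\varepsilon_s\in\{-1,0,1\}$. The lower 1-span dimension is $d_s^-(A)=\min\{|S|: S\subset G,\ \langle S\rangle\supset A\}$, where $G$ is the ambient group of $A$. *)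

theory Defs
  imports Complex_Main "HOL-Algebra.FiniteProduct"
begin

text \<open>
  Abelian groups are HOL-Algebra's \<^locale>\<open>comm_group\<close>, hence written multiplicatively:
  a sum of group elements is a \<^const>\<open>finprod\<close> and a multiple is a power \<open>[^]\<close>
  with an integer exponent.
\<close>

definition dissociated :: "('a, 'b) monoid_scheme \<Rightarrow> 'a set \<Rightarrow> bool" where
  "dissociated G D \<longleftrightarrow>
     D \<subseteq> carrier G \<and> inj_on (\<lambda>E. \<Otimes>\<^bsub>G\<^esub>x\<in>E. x) {E. E \<subseteq> D \<and> finite E}"

definition dissociativity_dim :: "('a, 'b) monoid_scheme \<Rightarrow> 'a set \<Rightarrow> nat" where
  "dissociativity_dim G A = Max {card D | D. D \<subseteq> A \<and> dissociated G D}"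

text \<open>Only meaningful for finite \<open>S\<close>, since \<^const>\<open>finprod\<close> is trivial on infinite index sets.\<close>

definition one_span :: "('a, 'b) monoid_scheme \<Rightarrow> 'a set \<Rightarrow> 'a set" where
  "one_span G S =
     {\<Otimes>\<^bsub>G\<^esub>s\<in>S. s [^]\<^bsub>G\<^esub> c s | c :: 'a \<Rightarrow> int. \<forall>s\<in>S. c s \<in> {-1, 0, 1}}"

text \<open>
  The spanning set \<open>S\<close> ranges over the whole ambient group, not only over subsets of \<open>A\<close>.
  A finite \<open>A\<close> lies in its own 1-span, so the minimum exists.
\<close>

definition lower_one_span_dim :: "('a, 'b) monoid_scheme \<Rightarrow> 'a set \<Rightarrow> nat" where
  "lower_one_span_dim G A =
     (LEAST n. \<exists>S. S \<subseteq> carrier G \<and> finite S \<and> card S = n \<and> A \<subseteq> one_span G S)"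

definition dim_ratio_bound :: "(nat \<Rightarrow> real) \<Rightarrow> ('a, 'b) monoid_scheme \<Rightarrow> bool" where
  "dim_ratio_bound \<epsilon> G \<longleftrightarrow>
     (\<forall>A. A \<subseteq> carrier G \<and> finite A \<and> dissociativity_dim G A \<ge> 2 \<longrightarrow>
        real (lower_one_span_dim G A) / real (dissociativity_dim G A)
          \<ge> 1 / log 4 (real (dissociativity_dim G A)) * (1 + \<epsilon> (dissociativity_dim G A)))"

text \<open>
  The error function must not depend on the group, in particular not on the type of its
  elements.  Within HOL an existential quantifier cannot be placed outside a quantification
  over types: in a statement \<open>\<exists>\<epsilon>. \<dots> (\<forall>G :: 'a monoid. \<dots>)\<close> the function \<open>\<epsilon>\<close> may depend on
  \<open>'a\<close>.  Uniformity is therefore expressed by two conjuncts: some error function tending to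
  \<open>0\<close> serves all abelian groups with elements in \<^typ>\<open>nat\<close>, a statement without type
  variables, and every function that serves these groups serves the abelian groups over an
  arbitrary type \<open>'a\<close>.  Together they give one single \<open>\<epsilon>\<close> that is valid for all abelian groups.
\<close>

end

theory Submission
  imports Defs "HOL-Probability.Hoeffding" "HOL-Algebra.Generated_Groups"
    "HOL-Algebra.Weak_Morphisms" "HOL-Real_Asymp.Real_Asymp"
begin

text \<open>
  Let \<open>D\<close> be a dissociated subset of \<open>A\<close> of maximal size \<open>d\<close>, and let \<open>S\<close> be a smallest set whose
  1-span contains \<open>A\<close>.  After choosing coefficients in \<open>{-1, 0, 1}\<close> for the elements of \<open>D\<close>, every
  \<open>E \<subseteq> D\<close> receives a coefficient vector indexed by \<open>S\<close>, and these \<open>2^d\<close> vectors are distinct.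
  Counting all vectors with entries of size at most \<open>d\<close> would lose a factor \<open>2\<close> in the result; but
  by Chernoff's bound and since we may assume \<open>card S \<le> d\<close>, for at least half of the \<open>E\<close>, each coordinate lies in an interval of length
  \<open>t = \<surd>(2 d ln (4 d))\<close> around its mean, so \<open>2^(d-1) \<le> (t + 1)^card S\<close>.

  An inequality of this kind for one abelian group only involves the finitely generated subgroup
  generated by \<open>A\<close> and \<open>S\<close>, which is countable and hence isomorphic to a group on natural numbers.
\<close>

section \<open>Concentration of subset sums\<close>

text \<open>Up to the factor 2 this is the exponential moment bound for a uniform random sign. Both
  sides are even, so the case \<open>x \<ge> 0\<close> suffices.\<close>

lemma cosh_le_exp_half_square:
  fixes x :: real
  shows "exp x + exp (- x) \<le> 2 * exp (x\<^sup>2 / 2)"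
proof -
  have *: "exp x + exp (- x) \<le> 2 * exp (x\<^sup>2 / 2)" if "x \<ge> 0" for x :: real
  proof -
    \<comment> \<open>The bound h^2/8 from Hoeffding's lemma, taken at h = 2x with success
      probability 1/2.\<close>
    have "- x + ln (1 + (exp (2 * x) - 1) / 2) \<le> x\<^sup>2 / 2"
      using Hoeffdings_lemma_aux[of "2 * x" "1 / 2"] that by (simp add: power2_eq_square)
    moreover have "1 + (exp (2 * x) - 1) / 2 > 0"
      using add_pos_pos[of 1 "exp (2 * x)"] by (simp add: field_simps)
    ultimately have "1 + (exp (2 * x) - 1) / 2 \<le> exp (x + x\<^sup>2 / 2)"
      by (metis add.commute diff_le_eq exp_le_cancel_iff exp_ln uminus_add_conv_diff)
    hence "exp (2 * x) + 1 \<le> 2 * exp (x + x\<^sup>2 / 2)"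
      by (simp add: field_simps)
    moreover have "exp x * (exp x + exp (- x)) = exp (2 * x) + 1"
      by (simp add: distrib_left flip: exp_add)
    moreover have "exp x * (2 * exp (x\<^sup>2 / 2)) = 2 * exp (x + x\<^sup>2 / 2)"
      by (simp add: exp_add)
    ultimately have "exp x * (exp x + exp (- x)) \<le> exp x * (2 * exp (x\<^sup>2 / 2))"
      by metis
    thus ?thesis by simp
  qed
  show ?thesis using *[of x] *[of "- x"] by (cases "x \<ge> 0") (simp_all add: add.commute)
qed

text \<open>\<open>2 * sum a E - sum a D\<close> is a signed sum over \<open>D\<close>, with sign
  plus on \<open>E\<close> and minus on \<open>D - E\<close>. Its exponential factors over
  \<open>D\<close>, so summing over all sign patterns expands a product of two-term factors.\<close>

lemma sum_Pow_exp_le: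
  fixes a :: "'a \<Rightarrow> real"
  assumes "finite D" and "\<And>x. x \<in> D \<Longrightarrow> \<bar>a x\<bar> \<le> 1"
  shows "(\<Sum>E\<in>Pow D. exp (l * (2 * sum a E - sum a D))) \<le> 2 ^ card D * exp (l\<^sup>2 * real (card D) / 2)"
proof -
  have "(\<Sum>E\<in>Pow D. exp (l * (2 * sum a E - sum a D))) =
      (\<Sum>E\<in>Pow D. (\<Prod>x\<in>E. exp (l * a x)) * (\<Prod>x\<in>D - E. exp (- (l * a x))))"
  proof (rule sum.cong)
    fix E assume "E \<in> Pow D"
    hence E: "E \<subseteq> D" "finite E" using assms(1) finite_subset by auto
    have "sum a D = sum a E + sum a (D - E)"
      using E assms(1) by (metis add.commute sum.subset_diff)
    thus "exp (l * (2 * sum a E - sum a D)) =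
        (\<Prod>x\<in>E. exp (l * a x)) * (\<Prod>x\<in>D - E. exp (- (l * a x)))"
      using E assms(1)
      by (simp add: algebra_simps sum_distrib_left sum_negf flip: exp_sum exp_add)
  qed simp
  also have "\<dots> = (\<Prod>x\<in>D. exp (l * a x) + exp (- (l * a x)))"
    using assms(1) by (rule prod_add[symmetric])
  also have "\<dots> \<le> (\<Prod>x\<in>D. 2 * exp (l\<^sup>2 / 2))"
  proof (rule prod_mono, intro conjI)
    fix x assume "x \<in> D"
    hence "(a x)\<^sup>2 \<le> 1" using assms(2) abs_le_square_iff[of "a x" 1] by simp
    hence "(l * a x)\<^sup>2 \<le> l\<^sup>2" by (simp add: power_mult_distrib mult_left_le)
    thus "exp (l * a x) + exp (- (l * a x)) \<le> 2 * exp (l\<^sup>2 / 2)"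
      using cosh_le_exp_half_square[of "l * a x"]
      by (smt (verit) divide_right_mono exp_le_cancel_iff)
  qed (simp add: add_nonneg_nonneg)
  also have "\<dots> = 2 ^ card D * exp (l\<^sup>2 * real (card D) / 2)"
    by (simp add: power_mult_distrib mult.commute flip: exp_of_nat_mult)
  finally show ?thesis .
qed

lemma card_subset_sum_upper_tail:
  fixes a :: "'a \<Rightarrow> real"
  assumes "finite D" and "D \<noteq> {}" and "\<And>x. x \<in> D \<Longrightarrow> \<bar>a x\<bar> \<le> 1" and "t \<ge> 0"
  shows "card {E \<in> Pow D. 2 * sum a E - sum a D > t} \<le> 2 ^ card D * exp (- t\<^sup>2 / (2 * real (card D)))"
    (is "real (card ?B) \<le> _")
proof -
  let ?d = "real (card D)"
  \<comment> \<open>Markov's inequality works for every \<open>l \<ge> 0\<close>; this value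
    minimises the exponent \<open>l\<^sup>2 * ?d / 2 - l * t\<close>.\<close>
  define l where "l = t / ?d"
  have d: "?d > 0" using assms(1,2) by (simp add: card_gt_0_iff)
  have "l \<ge> 0" using assms(4) d by (simp add: l_def)
  have "real (card ?B) * exp (l * t) = (\<Sum>E\<in>?B. exp (l * t))" by simp
  also have "\<dots> \<le> (\<Sum>E\<in>?B. exp (l * (2 * sum a E - sum a D)))"
    using \<open>l \<ge> 0\<close> by (intro sum_mono) (simp add: mult_left_mono)
  also have "\<dots> \<le> (\<Sum>E\<in>Pow D. exp (l * (2 * sum a E - sum a D)))"
    using assms(1) by (intro sum_mono2) auto
  also have "\<dots> \<le> 2 ^ card D * exp (l\<^sup>2 * ?d / 2)"
    using assms(1,3) by (rule sum_Pow_exp_le)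
  finally have "real (card ?B) \<le> 2 ^ card D * exp (l\<^sup>2 * ?d / 2) / exp (l * t)"
    by (simp add: pos_le_divide_eq)
  also have "\<dots> = 2 ^ card D * exp (l\<^sup>2 * ?d / 2 - l * t)"
    by (simp add: exp_diff)
  also have "l\<^sup>2 * ?d / 2 - l * t = - t\<^sup>2 / (2 * ?d)"
    using d by (simp add: l_def power2_eq_square divide_simps)
  finally show ?thesis .
qed

lemma card_subset_sum_tail:
  fixes a :: "'a \<Rightarrow> real"
  assumes "finite D" and "D \<noteq> {}" and "\<And>x. x \<in> D \<Longrightarrow> \<bar>a x\<bar> \<le> 1" and "t \<ge> 0"
  shows "card {E \<in> Pow D. \<bar>2 * sum a E - sum a D\<bar> > t}
    \<le> 2 ^ card D * (2 * exp (- t\<^sup>2 / (2 * real (card D))))"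
proof -
  have "{E \<in> Pow D. \<bar>2 * sum a E - sum a D\<bar> > t} =
      {E \<in> Pow D. 2 * sum a E - sum a D > t} \<union>
      {E \<in> Pow D. 2 * sum (\<lambda>x. - a x) E - sum (\<lambda>x. - a x) D > t}"
    by (auto simp: sum_negf)
  hence "card {E \<in> Pow D. \<bar>2 * sum a E - sum a D\<bar> > t} \<le>
      card {E \<in> Pow D. 2 * sum a E - sum a D > t} +
      card {E \<in> Pow D. 2 * sum (\<lambda>x. - a x) E - sum (\<lambda>x. - a x) D > t}"
    by (simp add: card_Un_le)
  moreover have "card {E \<in> Pow D. 2 * sum (\<lambda>x. - a x) E - sum (\<lambda>x. - a x) D > t}
      \<le> 2 ^ card D * exp (- t\<^sup>2 / (2 * real (card D)))"
    using assms by (intro card_subset_sum_upper_tail) auto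
  ultimately show ?thesis
    using card_subset_sum_upper_tail[where a = a, OF assms] by simp
qed

text \<open>The condition confines \<open>k\<close> to an interval of length \<open>t\<close> around
  \<open>m / 2\<close>. With \<open>m\<close> a sum over \<open>D\<close>, the centre
  \<open>m / 2\<close> is the mean of the subset sums.\<close>

lemma card_int_window_le:
  fixes m t :: real
  assumes "t \<ge> 0"
  shows "finite {k :: int. \<bar>2 * real_of_int k - m\<bar> \<le> t}" and "card {k :: int. \<bar>2 * real_of_int k - m\<bar> \<le> t} \<le> t + 1"
proof -
  have *: "{k :: int. \<bar>2 * real_of_int k - m\<bar> \<le> t} = {\<lceil>(m - t) / 2\<rceil>..\<lfloor>(m + t) / 2\<rfloor>}"
    by (auto simp: ceiling_le_iff le_floor_iff)
  show "finite {k :: int. \<bar>2 * real_of_int k - m\<bar> \<le> t}" by (simp add: *)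
  show "card {k :: int. \<bar>2 * real_of_int k - m\<bar> \<le> t} \<le> t + 1"
  proof -
    define z where "z = \<lfloor>(m + t) / 2\<rfloor> - \<lceil>(m - t) / 2\<rceil> + 1"
    have "p - q + 1 \<le> t + 1" if "p \<le> (m + t) / 2" "(m - t) / 2 \<le> q" for p q
      using that by argo
    from this[OF of_int_floor_le le_of_int_ceiling] have "real_of_int z \<le> t + 1"
      by (simp add: z_def)
    thus ?thesis
      unfolding * card_atLeastAtMost_int z_def[symmetric] using assms by (cases "z \<ge> 0") auto
  qed
qed

section \<open>Dissociated sets in the 1-span of a small set\<close>

lemma one_spanE:
  assumes "x \<in> one_span G S"
  obtains c :: "'a \<Rightarrow> int"
  where "x = (\<Otimes>\<^bsub>G\<^esub>s\<in>S. s [^]\<^bsub>G\<^esub> c s)" and "\<forall>s\<in>S. c s \<in> {-1, 0, 1}"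
  using assms by (auto simp: one_span_def)

context comm_group
begin

text \<open>Written additively: the coefficient vector of a subset sum is the sum of the vectors of
  its elements.\<close>

lemma finprod_finprod_int_pow:
  fixes c :: "'i \<Rightarrow> 'a \<Rightarrow> int"
  assumes "finite E" and "S \<subseteq> carrier G"
  shows "(\<Otimes>x\<in>E. \<Otimes>s\<in>S. s [^] c x s) = (\<Otimes>s\<in>S. s [^] (\<Sum>x\<in>E. c x s))"
  using assms(1)
proof induction
  case empty
  show ?case by (simp add: finprod_one_eqI)
next
  case (insert x E)
  have 1: "(\<lambda>s. s [^] (k s :: int)) \<in> S \<rightarrow> carrier G" for k using assms(2) by auto
  have "(\<Otimes>x\<in>insert x E. \<Otimes>s\<in>S. s [^] c x s) =
      (\<Otimes>s\<in>S. s [^] c x s) \<otimes> (\<Otimes>s\<in>S. s [^] (\<Sum>x\<in>E. c x s))"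
    using insert 1 by (simp add: finprod_closed)
  also have "\<dots> = (\<Otimes>s\<in>S. s [^] c x s \<otimes> s [^] (\<Sum>x\<in>E. c x s))"
    using 1 by (simp add: finprod_multf)
  also have "\<dots> = (\<Otimes>s\<in>S. s [^] (\<Sum>x\<in>insert x E. c x s))"
    using insert assms(2) by (intro finprod_cong') (auto simp: int_pow_mult subsetD)
  finally show ?case .
qed

lemma subset_one_span:
  assumes "finite A" and "A \<subseteq> carrier G"
  shows "A \<subseteq> one_span G A"
proof
  fix a assume a: "a \<in> A"
  define c :: "'a \<Rightarrow> int" where "c = (\<lambda>s. if a = s then 1 else 0)"
  have "(\<Otimes>s\<in>A. s [^] c s) = (\<Otimes>s\<in>A. if a = s then s else \<one>)"
    using assms(2) by (intro finprod_cong') (auto simp: c_def)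
  also have "\<dots> = a" using a assms by (intro finprod_singleton) auto
  finally have "a = (\<Otimes>s\<in>A. s [^] c s)" by simp
  moreover have "\<forall>s\<in>A. c s \<in> {-1, 0, 1}" by (simp add: c_def)
  ultimately show "a \<in> one_span G A" unfolding one_span_def by blast
qed

lemma lower_one_span_dim_attained:
  assumes "finite A" and "A \<subseteq> carrier G"
  obtains S where "S \<subseteq> carrier G" "finite S" "card S = lower_one_span_dim G A" "A \<subseteq> one_span G S"
proof -
  have "\<exists>n S. S \<subseteq> carrier G \<and> finite S \<and> card S = n \<and> A \<subseteq> one_span G S"
    using subset_one_span assms by blast
  hence "\<exists>S. S \<subseteq> carrier G \<and> finite S \<and> card S = lower_one_span_dim G A \<and> A \<subseteq> one_span G S"
    unfolding lower_one_span_dim_def by (rule LeastI_ex)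
  thus thesis using that by blast
qed

lemma dissociativity_dim_attained:
  assumes "finite A"
  obtains D where "D \<subseteq> A" "dissociated G D" "card D = dissociativity_dim G A"
proof -
  let ?X = "{card D | D. D \<subseteq> A \<and> dissociated G D}"
  have "finite ?X" using assms by simp
  moreover have "dissociated G {}" by (simp add: dissociated_def inj_on_def)
  hence "?X \<noteq> {}" by blast
  ultimately have "Max ?X \<in> ?X" by (rule Max_in)
  thus thesis using that by (auto simp: dissociativity_dim_def)
qed

text \<open>The second condition on \<open>t\<close> is a union bound over the coordinates: at most
  half of the subsets leave some window. The others inject into a product of windows with at most
  \<open>t + 1\<close> integers each.\<close>

lemma card_dissociated_le:
  assumes S: "S \<subseteq> carrier G" "finite S"
    and D: "D \<subseteq> one_span G S" "finite D" "D \<noteq> {}" "dissociated G D"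
    and t: "t \<ge> 0" "card S * (2 * exp (- t\<^sup>2 / (2 * real (card D)))) \<le> 1 / 2"
  shows "2 ^ card D \<le> 2 * (t + 1) ^ card S"
proof -
  have "\<forall>x\<in>D. \<exists>c :: 'a \<Rightarrow> int. x = (\<Otimes>s\<in>S. s [^] c s) \<and> (\<forall>s\<in>S. c s \<in> {-1, 0, 1})"
    using D(1) unfolding one_span_def by blast
  then obtain c :: "'a \<Rightarrow> 'a \<Rightarrow> int" where
    "\<forall>x\<in>D. x = (\<Otimes>s\<in>S. s [^] c x s) \<and> (\<forall>s\<in>S. c x s \<in> {-1, 0, 1})"
    by metis
  hence c: "x = (\<Otimes>s\<in>S. s [^] c x s)" "\<And>s. s \<in> S \<Longrightarrow> c x s \<in> {-1, 0, 1}" if "x \<in> D" for x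
    using that by blast+
  \<comment> \<open>Restriction to \<open>S\<close> makes \<open>v E\<close> extensional, so that it
    can lie in \<open>PiE S W\<close>.\<close>
  define v where "v E = (\<lambda>s\<in>S. \<Sum>x\<in>E. c x s)" for E
  have v: "(\<Otimes>x\<in>E. x) = (\<Otimes>s\<in>S. s [^] v E s)" if "E \<subseteq> D" for E
  proof -
    have "finite E" using that D(2) finite_subset by blast
    have "(\<Otimes>x\<in>E. x) = (\<Otimes>x\<in>E. \<Otimes>s\<in>S. s [^] c x s)"
      using that c(1) S(1) by (intro finprod_cong') (auto intro!: finprod_closed)
    also have "\<dots> = (\<Otimes>s\<in>S. s [^] (\<Sum>x\<in>E. c x s))"
      using \<open>finite E\<close> S(1) by (rule finprod_finprod_int_pow)
    also have "\<dots> = (\<Otimes>s\<in>S. s [^] v E s)"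
      using S(1) by (intro finprod_cong') (auto simp: v_def)
    finally show ?thesis .
  qed
  \<comment> \<open>\<open>v E\<close> determines the product over \<open>E\<close>, which
    determines \<open>E\<close> by dissociativity.\<close>
  have inj: "inj_on v (Pow D)"
  proof (rule inj_onI)
    fix E F assume *: "E \<in> Pow D" "F \<in> Pow D" "v E = v F"
    hence "(\<Otimes>x\<in>E. x) = (\<Otimes>x\<in>F. x)" using v by simp
    thus "E = F"
      using D(2,4) * finite_subset unfolding dissociated_def inj_on_def by blast
  qed
  \<comment> \<open>Coordinate \<open>s\<close> of \<open>v E\<close> differs from its mean over all
    subsets of \<open>D\<close> by more than \<open>t / 2\<close>.\<close>
  define bad where "bad s = {E \<in> Pow D. \<bar>2 * (\<Sum>x\<in>E. real_of_int (c x s)) -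
    (\<Sum>x\<in>D. real_of_int (c x s))\<bar> > t}" for s
  define good where "good = Pow D - (\<Union>s\<in>S. bad s)"
  define W where "W s = {k :: int. \<bar>2 * real_of_int k - (\<Sum>x\<in>D. real_of_int (c x s))\<bar> \<le> t}" for s
  have "real (card (\<Union>s\<in>S. bad s)) \<le> real (\<Sum>s\<in>S. card (bad s))"
    using S(2) card_UN_le of_nat_mono by blast
  also have "\<dots> \<le> (\<Sum>s\<in>S. 2 ^ card D * (2 * exp (- t\<^sup>2 / (2 * real (card D)))))"
    unfolding of_nat_sum
  proof (rule sum_mono)
    fix s assume "s \<in> S"
    thus "real (card (bad s)) \<le> 2 ^ card D * (2 * exp (- t\<^sup>2 / (2 * real (card D))))"
      unfolding bad_def using c(2) D(2,3) t(1) by (intro card_subset_sum_tail) fastforce+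
  qed
  also have "\<dots> = 2 ^ card D * (card S * (2 * exp (- t\<^sup>2 / (2 * real (card D)))))" by simp
  also have "\<dots> \<le> 2 ^ card D * (1 / 2)" using t(2) by (intro mult_left_mono) auto
  finally have bad: "real (card (\<Union>s\<in>S. bad s)) \<le> 2 ^ card D / 2" by simp
  have "card (Pow D) - card (\<Union>s\<in>S. bad s) \<le> card good"
    unfolding good_def by (rule diff_card_le_card_Diff) (auto simp: S(2) D(2) bad_def)
  hence "2 ^ card D \<le> real (card good + card (\<Union>s\<in>S. bad s))"
    using D(2) by (simp add: card_Pow flip: of_nat_power of_nat_add)
  hence "2 ^ card D \<le> 2 * real (card good)" using bad by simp
  also have "card good \<le> card (PiE S W)"
  proof (rule card_inj_on_le)
    show "inj_on v good" using inj by (rule inj_on_subset) (auto simp: good_def)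
    show "v ` good \<subseteq> PiE S W"
      by (fastforce simp: v_def good_def bad_def W_def)
    show "finite (PiE S W)"
      using S(2) t(1) by (intro finite_PiE) (auto simp: W_def card_int_window_le)
  qed
  hence "2 * real (card good) \<le> 2 * real (card (PiE S W))" by simp
  also have "real (card (PiE S W)) = (\<Prod>s\<in>S. real (card (W s)))"
    using S(2) by (simp add: card_PiE)
  also have "\<dots> \<le> (\<Prod>s\<in>S. t + 1)"
    unfolding W_def using t(1) by (intro prod_mono) (auto intro: card_int_window_le)
  also have "\<dots> = (t + 1) ^ card S" by simp
  finally show ?thesis by simp
qed

section \<open>The error function and the bound in a single group\<close>

text \<open>The solution \<epsilon> of
  \<open>(d - 1) / (d * L) = (1 + \<epsilon>) / log 4 d\<close>, where \<open>L\<close> is the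
  logarithm to base 2 in the denominator. It refers to no group, as uniformity demands.\<close>

definition (in -) dim_ratio_error :: "nat \<Rightarrow> real" where
  "dim_ratio_error d = (1 - 1 / d) * log 4 d / log 2 (sqrt (2 * d * ln (4 * d)) + 1) - 1"

text \<open>The square root makes the denominator asymptotic to half of \<open>log 2 d\<close>,
  which is \<open>log 4 d\<close>; this is the source of base 4.\<close>

lemma (in -) dim_ratio_error_tendsto: "dim_ratio_error \<longlonglongrightarrow> 0"
proof -
  have "ln (4 :: real) = 2 * ln 2" using ln_realpow[of "2 :: real" 2] by simp
  thus ?thesis unfolding dim_ratio_error_def log_def by simp real_asymp
qed

lemma dim_ratio_bound_error: "dim_ratio_bound dim_ratio_error G"
  unfolding dim_ratio_bound_def
proof (intro allI impI, elim conjE)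
  fix A assume A: "A \<subseteq> carrier G" "finite A" and d2: "dissociativity_dim G A \<ge> 2"
  obtain S where S: "S \<subseteq> carrier G" "finite S" "card S = lower_one_span_dim G A"
    "A \<subseteq> one_span G S"
    using lower_one_span_dim_attained A by blast
  obtain D where D: "D \<subseteq> A" "dissociated G D" "card D = dissociativity_dim G A"
    using dissociativity_dim_attained A(2) by blast
  define d where "d = card D"
  define n where "n = card S"
  \<comment> \<open>Chosen so that \<open>exp (- t\<^sup>2 / (2 * d))\<close> equals
    \<open>1 / (4 * d)\<close>; for \<open>n \<le> d\<close> the union bound then loses at most the
    fraction 1/2.\<close>
  define t where "t = sqrt (2 * d * ln (4 * d))"
  have d: "d \<ge> 2" using d2 D(3) by (simp add: d_def)
  have ln4: "ln (4 * real d) \<ge> 1"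
  proof -
    have "exp 1 \<le> 4 * real d" using exp_le d by simp
    thus ?thesis using d by (subst ln_ge_iff) auto
  qed
  have t2: "t\<^sup>2 = 2 * d * ln (4 * d)" using ln4 by (simp add: t_def)
  have t1: "t \<ge> 1"
  proof -
    have "1 * 1 \<le> (2 * real d) * ln (4 * d)" using ln4 d by (intro mult_mono) auto
    thus ?thesis by (simp add: t_def)
  qed
  define L where "L = log 2 (t + 1)"
  have L: "L \<ge> 1" using t1 by (simp add: L_def)
  \<comment> \<open>If \<open>n > d\<close>, this is immediate from \<open>L \<ge> 1\<close>.
    Otherwise take logarithms in the counting bound; the subtracted 1 pays for the discarded half of
    the subsets.\<close>
  have "d - 1 \<le> n * L"
  proof (cases "n \<le> d")
    case True
    have e: "exp (- t\<^sup>2 / (2 * real d)) = 1 / (4 * d)"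
      using d by (simp add: t2 exp_minus field_simps)
    hence "n * (2 * exp (- t\<^sup>2 / (2 * real d))) \<le> 1 / 2"
      unfolding e using True d by (simp add: field_simps)
    hence "2 ^ d \<le> 2 * (t + 1) ^ n"
      unfolding d_def n_def using S D d t1 A(2)
      by (intro card_dissociated_le) (auto intro: finite_subset simp: d_def)
    hence "log 2 (2 ^ d) \<le> log 2 (2 * (t + 1) ^ n)" using t1 by (subst log_le_cancel_iff) auto
    also have "\<dots> = 1 + n * L" using t1 by (simp add: log_mult log_nat_power L_def)
    finally show ?thesis using d by (simp add: of_nat_diff)
  next
    case False
    hence "real (d - 1) * 1 \<le> n * L" using L by (intro mult_mono) auto
    thus ?thesis by simp
  qed
  hence "(real d - 1) / L \<le> n" using L by (simp add: pos_divide_le_eq of_nat_diff d_def)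
  hence "(real d - 1) / L / d \<le> real n / d" by (intro divide_right_mono) auto
  moreover have "1 / log 4 d * (1 + dim_ratio_error d) = (real d - 1) / L / d"
  proof -
    have err: "dim_ratio_error d = (1 - 1 / d) * log 4 d / L - 1"
      by (simp add: dim_ratio_error_def L_def t_def)
    have "1 / x * (1 + ((1 - 1 / d) * x / L - 1)) = (real d - 1) / L / d" if "x > 0" for x
      using that d L by (simp add: field_simps)
    from this[of "log 4 d"] show ?thesis using d unfolding err by simp
  qed
  ultimately show "real (lower_one_span_dim G A) / real (dissociativity_dim G A) \<ge>
      1 / log 4 (real (dissociativity_dim G A)) * (1 + dim_ratio_error (dissociativity_dim G A))"
    using S(3) D(3) by (simp add: d_def n_def)
qed

end

section \<open>Transfer along injective homomorphisms\<close>

locale comm_group_embedding = K: comm_group K + G: comm_group G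
  for K (structure) and G (structure) +
  fixes h
  assumes hom: "h \<in> hom K G" and inj: "inj_on h (carrier K)"
begin

lemma closed: "x \<in> carrier K \<Longrightarrow> h x \<in> carrier G"
  using hom by (auto simp: hom_def)

lemma finprod_hom:
  assumes "f \<in> E \<rightarrow> carrier K"
  shows "h (finprod K f E) = finprod G (\<lambda>x. h (f x)) E"
proof (cases "finite E")
  case True
  thus ?thesis using assms
  proof (induction E)
    case empty
    show ?case using hom_one[OF hom] K.group_axioms G.group_axioms by simp
  next
    case (insert x E)
    thus ?case using closed by (simp add: hom_mult[OF hom] K.finprod_closed Pi_iff)
  qed
next
  \<comment> \<open>Over an infinite index set \<open>finprod\<close> defaults to the neutral
    element, which \<open>h\<close> preserves.\<close>
  case False
  thus ?thesis using hom_one[OF hom] K.group_axioms G.group_axioms by simp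
qed

lemma finprod_image:
  assumes "E \<subseteq> carrier K" and "f \<in> h ` E \<rightarrow> carrier G"
  shows "finprod G f (h ` E) = finprod G (\<lambda>x. f (h x)) E"
  using assms inj by (intro G.finprod_reindex) (auto intro: inj_on_subset)

text \<open>Taking images matches the finite subsets of \<open>D\<close> with those of its image and
  carries subset products to subset products. These lie in the carrier of \<open>K\<close>, where
  \<open>h\<close> is injective, so coincidences are preserved and reflected.\<close>

lemma dissociated_image_iff:
  assumes "D \<subseteq> carrier K"
  shows "dissociated G (h ` D) \<longleftrightarrow> dissociated K D"
proof -
  let ?X = "{E. E \<subseteq> D \<and> finite E}"
  let ?F = "\<lambda>E. \<Otimes>\<^bsub>K\<^esub>x\<in>E. x" and ?H = "\<lambda>E. \<Otimes>\<^bsub>G\<^esub>x\<in>E. x"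
  have injD: "inj_on h D" using inj assms by (rule inj_on_subset)
  have X: "{E. E \<subseteq> h ` D \<and> finite E} = (`) h ` ?X"
    by (auto simp: image_iff) (metis finite_subset_image)
  have "inj_on ((`) h) ?X"
    using inj_on_image_Pow[OF injD] by (rule inj_on_subset) auto
  hence "inj_on ?H ((`) h ` ?X) \<longleftrightarrow> inj_on (\<lambda>E. ?H (h ` E)) ?X"
    by (simp add: comp_inj_on_iff o_def)
  also have "\<dots> \<longleftrightarrow> inj_on (\<lambda>E. h (?F E)) ?X"
  proof (rule inj_on_cong)
    fix E assume "E \<in> ?X"
    thus "?H (h ` E) = h (?F E)"
      using assms closed by (subst finprod_image) (auto simp: finprod_hom[of "\<lambda>x. x" E] subset_eq)
  qed
  also have "\<dots> \<longleftrightarrow> inj_on ?F ?X"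
  proof -
    have "?F ` ?X \<subseteq> carrier K" using assms by (auto intro!: K.finprod_closed)
    hence "inj_on h (?F ` ?X)" using inj inj_on_subset by blast
    thus ?thesis using comp_inj_on[of ?F ?X h] inj_on_imageI2[of h ?F ?X] by (auto simp: o_def)
  qed
  finally show ?thesis
    unfolding dissociated_def X using assms closed by auto
qed

lemma dissociativity_dim_image:
  assumes "B \<subseteq> carrier K"
  shows "dissociativity_dim G (h ` B) = dissociativity_dim K B"
proof -
  have card: "card (h ` D) = card D" if "D \<subseteq> B" for D
    using that assms inj by (intro card_image) (meson inj_on_subset order_trans)
  have "{card D | D. D \<subseteq> h ` B \<and> dissociated G D} = {card D | D. D \<subseteq> B \<and> dissociated K D}"
  proof (intro equalityI subsetI)
    fix m assume "m \<in> {card D | D. D \<subseteq> h ` B \<and> dissociated G D}"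
    then obtain D where "D \<subseteq> B" "dissociated G (h ` D)" "m = card (h ` D)"
      by (auto simp: subset_image_iff)
    thus "m \<in> {card D | D. D \<subseteq> B \<and> dissociated K D}"
      using dissociated_image_iff[of D] card assms by auto
  next
    fix m assume "m \<in> {card D | D. D \<subseteq> B \<and> dissociated K D}"
    then obtain D where "D \<subseteq> B" "dissociated K D" "m = card (h ` D)" using card by auto
    thus "m \<in> {card D | D. D \<subseteq> h ` B \<and> dissociated G D}"
      using dissociated_image_iff[of D] assms by blast
  qed
  thus ?thesis by (simp add: dissociativity_dim_def)
qed

text \<open>Coefficients representing \<open>h b\<close> are pulled back along \<open>h\<close>; the
  resulting product in \<open>K\<close> has the same image as \<open>b\<close>, hence equals
  \<open>b\<close>.\<close>

lemma subset_one_span_if_image: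
  assumes "B \<subseteq> carrier K" and "S \<subseteq> carrier K" and "h ` B \<subseteq> one_span G (h ` S)"
  shows "B \<subseteq> one_span K S"
proof
  fix b assume b: "b \<in> B"
  then obtain c :: "_ \<Rightarrow> int" where
    c: "h b = (\<Otimes>\<^bsub>G\<^esub>s\<in>h ` S. s [^]\<^bsub>G\<^esub> c s)" "\<forall>s\<in>h ` S. c s \<in> {-1, 0, 1}"
    using assms(3) by (auto elim!: one_spanE)
  have pow: "h s [^]\<^bsub>G\<^esub> c (h s) = h (s [^]\<^bsub>K\<^esub> c (h s))" if "s \<in> S" for s
    using that assms(2) hom_int_pow[OF hom] K.group_axioms G.group_axioms by auto
  have "h b = (\<Otimes>\<^bsub>G\<^esub>s\<in>S. h s [^]\<^bsub>G\<^esub> c (h s))"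
    using assms(2) closed by (subst c(1), subst finprod_image) auto
  also have "\<dots> = (\<Otimes>\<^bsub>G\<^esub>s\<in>S. h (s [^]\<^bsub>K\<^esub> c (h s)))"
    using assms(2) closed pow by (intro G.finprod_cong') auto
  also have "\<dots> = h (\<Otimes>\<^bsub>K\<^esub>s\<in>S. s [^]\<^bsub>K\<^esub> c (h s))"
    using assms(2) by (intro finprod_hom[symmetric]) auto
  finally have "b = (\<Otimes>\<^bsub>K\<^esub>s\<in>S. s [^]\<^bsub>K\<^esub> c (h s))"
    using b assms(1,2) by (intro inj_onD[OF inj]) (auto intro!: K.finprod_closed)
  moreover have "\<forall>s\<in>S. c (h s) \<in> {-1, 0, 1}" using c(2) by blast
  ultimately show "b \<in> one_span K S"
    unfolding one_span_def by (intro CollectI exI[of _ "\<lambda>s. c (h s)"] conjI)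
qed

end

section \<open>Reduction to groups on natural numbers\<close>

text \<open>Every element is the value of a finite word in elements of \<open>T\<close> and their
  inverses, and there are only countably many words.\<close>

lemma (in group) countable_generate:
  assumes "countable T" and "T \<subseteq> carrier G"
  shows "countable (generate G T)"
proof -
  let ?U = "T \<union> (\<lambda>x. inv x) ` T"
  let ?p = "\<lambda>w. foldr (\<otimes>) w \<one>"
  have p_closed: "?p w \<in> carrier G" if "w \<in> lists ?U" for w
    using that assms(2) by (induction w) auto
  have p_append: "?p (u @ w) = ?p u \<otimes> ?p w" if "u \<in> lists ?U" "w \<in> lists ?U" for u w
    using that(1)
  proof (induction u)
    case Nil
    show ?case using p_closed[OF that(2)] by simp
  next
    case (Cons x u)
    have "x \<in> carrier G" using Cons.hyps(1) assms(2) by auto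
    thus ?case using Cons p_closed that(2) by (simp add: m_assoc)
  qed
  have "generate G T \<subseteq> ?p ` lists ?U"
  proof
    fix x assume "x \<in> generate G T"
    thus "x \<in> ?p ` lists ?U"
    proof induction
      case one
      show ?case by (rule image_eqI[of _ _ "[]"]) auto
    next
      case (incl x)
      thus ?case using assms(2) by (intro image_eqI[of _ _ "[x]"]) auto
    next
      case (inv x)
      thus ?case using assms(2) by (intro image_eqI[of _ _ "[inv x]"]) auto
    next
      case (eng x y)
      then obtain u w where "u \<in> lists ?U" "x = ?p u" "w \<in> lists ?U" "y = ?p w" by auto
      thus ?case using p_append by (intro image_eqI[of _ _ "u @ w"]) auto
    qed
  qed
  moreover have "countable (lists ?U)" using assms(1) by (intro countable_lists) auto
  ultimately show ?thesis by (meson countable_image countable_subset)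
qed

text \<open>Numbering the countable subgroup generated by \<open>T\<close> transports its structure
  to natural numbers; \<open>h\<close> undoes the numbering.\<close>

lemma (in comm_group) countable_subset_embedding:
  assumes "countable T" and "T \<subseteq> carrier G"
  obtains K :: "nat monoid" and h where "comm_group_embedding K G h" and "T \<subseteq> h ` carrier K"
proof -
  define H where "H = subgroup_generated G T"
  have H: "comm_group H"
    unfolding H_def using comm_group_axioms by (rule abelian_subgroup_generated)
  interpret H: comm_group H by (rule H)
  have "countable (carrier H)"
    unfolding H_def carrier_subgroup_generated using assms
    by (intro countable_generate) (auto intro: countable_subset)
  define f where "f = to_nat_on (carrier H)"
  have f: "inj_on f (carrier H)" unfolding f_def using \<open>countable (carrier H)\<close> by (rule inj_on_to_nat_on)
  define K where "K = image_group f H"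
  define h where "h = inv_into (carrier H) f"
  have iso: "f \<in> iso H K" unfolding K_def using f by (rule inj_imp_image_group_iso)
  have h: "h \<in> iso K H" unfolding h_def using iso by (rule H.iso_set_sym)
  have "group K" unfolding K_def using f by (rule H.inj_imp_image_group_is_group)
  hence "comm_group K"
    using iso by (intro H.iso_imp_comm_group) (auto simp: is_iso_def group.is_monoid)
  moreover have "carrier H \<subseteq> carrier G"
    by (simp add: H_def carrier_subgroup_generated_subset)
  hence "h \<in> hom K G" using h by (auto simp: iso_def hom_def H_def)
  moreover have "inj_on h (carrier K)" using h by (auto simp: iso_def bij_betw_def)
  ultimately have "comm_group_embedding K G h"
    using comm_group_axioms
    by (simp add: comm_group_embedding_def comm_group_embedding_axioms_def)
  moreover have "h ` carrier K = carrier H" using h by (auto simp: iso_def bij_betw_def)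
  hence "T \<subseteq> h ` carrier K"
    using subgroup_generated_subset_carrier_subset[OF assms(2)] by (simp add: H_def)
  ultimately show thesis by (rule that)
qed

text \<open>Passing to \<open>K\<close> keeps the dissociativity dimension and does not raise the
  lower 1-span dimension, so the bound in \<open>K\<close> implies the one in
  \<open>G\<close>.\<close>

lemma (in comm_group) dim_ratio_bound_if_nat:
  assumes "\<And>K :: nat monoid. comm_group K \<Longrightarrow> dim_ratio_bound \<epsilon> K"
  shows "dim_ratio_bound \<epsilon> G"
  unfolding dim_ratio_bound_def
proof (intro allI impI, elim conjE)
  fix A assume A: "A \<subseteq> carrier G" "finite A" and d2: "dissociativity_dim G A \<ge> 2"
  obtain S where S: "S \<subseteq> carrier G" "finite S" "card S = lower_one_span_dim G A"
    "A \<subseteq> one_span G S"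
    using lower_one_span_dim_attained A by blast
  \<comment> \<open>An optimal \<open>S\<close> is embedded together with \<open>A\<close>: it
    ranges over the ambient group and may leave the subgroup generated by \<open>A\<close>.\<close>
  have "countable (A \<union> S)" "A \<union> S \<subseteq> carrier G"
    using A S(1,2) by (auto intro: countable_finite)
  then obtain K :: "nat monoid" and h where
    "comm_group_embedding K G h" and AS: "A \<union> S \<subseteq> h ` carrier K"
    by (rule countable_subset_embedding)
  interpret comm_group_embedding K G h by fact
  obtain B where B: "B \<subseteq> carrier K" "A = h ` B" using AS by (meson Un_subset_iff subset_imageE)
  obtain R where R: "R \<subseteq> carrier K" "S = h ` R" using AS by (meson Un_subset_iff subset_imageE)
  have injB: "inj_on h B" and injR: "inj_on h R" using inj B R inj_on_subset by blast+
  have finB: "finite B" using A(2) B injB by (simp add: finite_image_iff)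
  have finR: "finite R" using S(2) R injR by (simp add: finite_image_iff)
  have dim: "dissociativity_dim K B = dissociativity_dim G A"
    using dissociativity_dim_image B by simp
  have "B \<subseteq> one_span K R" using subset_one_span_if_image B R S(4) by simp
  hence "lower_one_span_dim K B \<le> card R"
    unfolding lower_one_span_dim_def using R(1) finR by (intro Least_le) blast
  also have "\<dots> = lower_one_span_dim G A" using S(3) R(2) injR by (simp add: card_image)
  finally have le: "real (lower_one_span_dim K B) \<le> real (lower_one_span_dim G A)" by simp
  have "real (lower_one_span_dim K B) / real (dissociativity_dim K B) \<ge>
      1 / log 4 (real (dissociativity_dim K B)) * (1 + \<epsilon> (dissociativity_dim K B))"
    using assms[OF K.comm_group_axioms] B(1) finB d2 dim by (auto simp: dim_ratio_bound_def)
  thus "real (lower_one_span_dim G A) / real (dissociativity_dim G A) \<ge>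
      1 / log 4 (real (dissociativity_dim G A)) * (1 + \<epsilon> (dissociativity_dim G A))"
    unfolding dim by (rule order_trans) (intro divide_right_mono le of_nat_0_le_iff)
qed

theorem theorem1p4:
  "(\<exists>\<epsilon> :: nat \<Rightarrow> real. \<epsilon> \<longlonglongrightarrow> 0 \<and>
      (\<forall>G :: nat monoid. comm_group G \<longrightarrow> dim_ratio_bound \<epsilon> G)) \<and>
   (\<forall>\<epsilon> :: nat \<Rightarrow> real.
      (\<forall>G :: nat monoid. comm_group G \<longrightarrow> dim_ratio_bound \<epsilon> G) \<longrightarrow>
      (\<forall>G :: 'a monoid. comm_group G \<longrightarrow> dim_ratio_bound \<epsilon> G))"
  using dim_ratio_error_tendsto comm_group.dim_ratio_bound_error comm_group.dim_ratio_bound_if_nat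
  by blast

end
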